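(* Let $X$ be an infinite dimensional Banach space. If $X$ contains a weakly null complemented basic sequence $(e_n)$, then $X$ can be renormed with a relative Daugavet-point; that is, there exists an equivalent norm $|||\cdot|||$ on $X$ such that $(X,|||\cdot|||)$ contains a relative Daugavet-point.
   Context: All Banach spaces are real. A sequence $(e_n)$ is weakly null if $e_n\to 0$ in the weak topology; it is basic if it is a Schauder basis of its closed linear span; a basic sequence in $X$ is complemented if its closed linear span is a complemented subspace of $X$. For a Banach space $Z$, $B_Z$ and $S_Z$ denote its closed unit ball and unit sphere, and $Z^*$ its topological dual. A slice of $B_Z$ is a set of the form $S(z^*,\alpha)=\{y\in B_Z:\ z^*(y)>\sup z^*(B_Z)-\alpha\}$ with $z^*\in Z^*$ and $\alpha>0$. For $z\in S_Z$ let $D(z)=\{z^*\in S_{Z^*}:\ z^*(z)=1\}$; a supporting slice at $z$ is a slice $S(z^*,\alpha)$ with $z^*\in D(z)$ and $\alpha>0$. A point $z\in S_Z$ is a Daugavet-point relative to a supporting slice $S$ at $z$ if $\sup_{y\in T}\|z-y\|=2$ for every slice $T$ of $B_Z$ with $T\subseteq S$. A point $z\in S_Z$ is a relative Daugavet-point if it is a Daugavet-point relative to some supporting slice at $z$. *)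

theory Defs
  imports "HOL-Analysis.Analysis"
begin

definition infinite_dimensional :: "'a::real_vector itself \<Rightarrow> bool" where
  "infinite_dimensional _ \<longleftrightarrow> \<not> (\<exists>B::'a set. finite B \<and> span B = UNIV)"

(* The coarsest topology making every bounded linear functional continuous. *)
definition weak_topology :: "'a::real_normed_vector topology" where
  "weak_topology =
     topology_generated_by {f -` U | (f :: 'a \<Rightarrow> real) U. bounded_linear f \<and> open U}"

definition weakly_null :: "(nat \<Rightarrow> 'a::real_normed_vector) \<Rightarrow> bool" where
  "weakly_null e \<longleftrightarrow> limitin weak_topology e 0 sequentially"

definition closed_span :: "'a::real_normed_vector set \<Rightarrow> 'a set" where
  "closed_span A = closure (span A)"

definition schauder_basis_of :: "(nat \<Rightarrow> 'a::real_normed_vector) \<Rightarrow> 'a set \<Rightarrow> bool" where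
  "schauder_basis_of e Y \<longleftrightarrow>
     range e \<subseteq> Y \<and> (\<forall>x\<in>Y. \<exists>!a :: nat \<Rightarrow> real. (\<lambda>n. a n *\<^sub>R e n) sums x)"

definition basic_sequence :: "(nat \<Rightarrow> 'a::real_normed_vector) \<Rightarrow> bool" where
  "basic_sequence e \<longleftrightarrow> schauder_basis_of e (closed_span (range e))"

definition complemented_subspace :: "'a::real_normed_vector set \<Rightarrow> bool" where
  "complemented_subspace Y \<longleftrightarrow>
     (\<exists>P :: 'a \<Rightarrow> 'a. bounded_linear P \<and> (\<forall>x. P (P x) = P x) \<and> range P = Y)"

(* A renorming of the space is represented by a second norm N on the same type.  The notions
   below refer to the normed space with norm N and use N only. *)

definition is_norm :: "('a::real_vector \<Rightarrow> real) \<Rightarrow> bool" where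
  "is_norm N \<longleftrightarrow>
     (\<forall>x. 0 \<le> N x) \<and> (\<forall>x. N x = 0 \<longleftrightarrow> x = 0) \<and>
     (\<forall>c x. N (c *\<^sub>R x) = \<bar>c\<bar> * N x) \<and> (\<forall>x y. N (x + y) \<le> N x + N y)"

definition equivalent_norm :: "('a::real_normed_vector \<Rightarrow> real) \<Rightarrow> bool" where
  "equivalent_norm N \<longleftrightarrow>
     is_norm N \<and> (\<exists>c>0. \<exists>C>0. \<forall>x. c * norm x \<le> N x \<and> N x \<le> C * norm x)"

definition unit_ball :: "('a::real_vector \<Rightarrow> real) \<Rightarrow> 'a set" where
  "unit_ball N = {x. N x \<le> 1}"

definition unit_sphere :: "('a::real_vector \<Rightarrow> real) \<Rightarrow> 'a set" where
  "unit_sphere N = {x. N x = 1}"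

definition dual :: "('a::real_vector \<Rightarrow> real) \<Rightarrow> ('a \<Rightarrow> real) set" where
  "dual N = {f. linear f \<and> (\<exists>K. \<forall>x. \<bar>f x\<bar> \<le> K * N x)}"

definition dual_norm :: "('a::real_vector \<Rightarrow> real) \<Rightarrow> ('a \<Rightarrow> real) \<Rightarrow> real" where
  "dual_norm N f = (SUP x\<in>unit_ball N. \<bar>f x\<bar>)"

definition slice :: "('a::real_vector \<Rightarrow> real) \<Rightarrow> ('a \<Rightarrow> real) \<Rightarrow> real \<Rightarrow> 'a set" where
  "slice N f \<alpha> = {y \<in> unit_ball N. f y > (SUP x\<in>unit_ball N. f x) - \<alpha>}"

definition is_slice :: "('a::real_vector \<Rightarrow> real) \<Rightarrow> 'a set \<Rightarrow> bool" where
  "is_slice N T \<longleftrightarrow> (\<exists>f\<in>dual N. \<exists>\<alpha>>0. T = slice N f \<alpha>)"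

definition supporting_functionals ::
    "('a::real_vector \<Rightarrow> real) \<Rightarrow> 'a \<Rightarrow> ('a \<Rightarrow> real) set" where
  "supporting_functionals N z = {f \<in> dual N. dual_norm N f = 1 \<and> f z = 1}"

definition is_supporting_slice :: "('a::real_vector \<Rightarrow> real) \<Rightarrow> 'a \<Rightarrow> 'a set \<Rightarrow> bool" where
  "is_supporting_slice N z S \<longleftrightarrow>
     (\<exists>f\<in>supporting_functionals N z. \<exists>\<alpha>>0. S = slice N f \<alpha>)"

definition daugavet_point_relative_to ::
    "('a::real_vector \<Rightarrow> real) \<Rightarrow> 'a \<Rightarrow> 'a set \<Rightarrow> bool" where
  "daugavet_point_relative_to N z S \<longleftrightarrow>
     z \<in> unit_sphere N \<and> is_supporting_slice N z S \<and>
     (\<forall>T. is_slice N T \<and> T \<subseteq> S \<longrightarrow> (SUP y\<in>T. N (z - y)) = 2)"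

definition relative_daugavet_point :: "('a::real_vector \<Rightarrow> real) \<Rightarrow> 'a \<Rightarrow> bool" where
  "relative_daugavet_point N z \<longleftrightarrow>
     (\<exists>S. daugavet_point_relative_to N z S)"

end

theory Submission
  imports Defs
begin

text \<open>The idea is to find a bounded set \<open>U\<close> whose closed convex hull contains zero although its
  elements are, in a one-sided sense, uniformly biorthogonal: for each \<open>w \<in> U\<close> some functional takes
  the value \<open>1\<close> at \<open>w\<close> and values in \<open>{0..1}\<close> on \<open>U\<close>, with a common bound for all of these functionals.
  Take a vector \<open>z\<close> on which these functionals may be prescribed to be \<open>- 1\<close>, and a functional \<open>f\<close>
  with \<open>f z = 1\<close> that vanishes on \<open>U\<close>. Let the new unit ball be generated by the points
  \<open>z + 2 *\<^sub>R w\<close> with \<open>w \<in> U\<close>, their negatives and a small ball. Then \<open>z\<close> lies on the new unit sphere,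
  but the only generators that a slice inside \<open>{f > 1 / 2}\<close> can contain are points \<open>z + 2 *\<^sub>R w\<close>, and
  each slice contains a generator. The functionals above show that \<open>w\<close> has norm \<open>1\<close>, so that
  \<open>z + 2 *\<^sub>R w\<close> is at distance \<open>2\<close> from \<open>z\<close>. This is \<open>relative_daugavet_renorming\<close>.

  Such a set exists as soon as there are unit vectors \<open>v n\<close> with uniformly bounded biorthogonal
  functionals. One cannot take \<open>U = range v\<close>, since zero may be far from the convex hull of
  \<open>range v\<close>, as for the unit vectors of the space of summable sequences. Instead, blocks of the
  \<open>v n\<close> are centred by subtracting their mean, and one further vector per block repairs the small
  negative coefficients that centring creates; see
  \<open>relative_daugavet_renorming_of_biorthogonal\<close>.

  A biorthogonal system of this kind comes from the basic sequence: the coefficient functionals of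
  a Schauder basis are bounded by a Baire category argument (\<open>basis_partial_sums_bounded\<close>), and the
  projection onto the closed span extends them to the whole space.\<close>

section \<open>The gauge of a symmetric convex body\<close>

locale symmetric_convex_body =
  fixes K :: "'a::real_normed_vector set" and d R :: real
  assumes convex: "convex K"
    and symmetric: "x \<in> K \<Longrightarrow> - x \<in> K"
    and d_pos: "0 < d" and ball_subset: "cball 0 d \<subseteq> K"
    and norm_bound: "x \<in> K \<Longrightarrow> norm x \<le> R"
begin

definition gauge_norm :: "'a \<Rightarrow> real" where
  "gauge_norm x = Inf {t. 0 < t \<and> (1 / t) *\<^sub>R x \<in> K}"

lemma zero_mem: "0 \<in> K"
  using ball_subset d_pos by auto

lemma gauge_norm_le: "0 < t \<Longrightarrow> (1 / t) *\<^sub>R x \<in> K \<Longrightarrow> gauge_norm x \<le> t"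
  unfolding gauge_norm_def by (intro cInf_lower bdd_belowI[of _ 0]) auto

lemma scaled_mem:
  assumes "norm x \<le> d * t" "0 < t"
  shows "(1 / t) *\<^sub>R x \<in> K"
  using assms ball_subset by (auto simp: subset_iff field_simps)

lemma gauge_norm_set_nonempty: "{t. 0 < t \<and> (1 / t) *\<^sub>R x \<in> K} \<noteq> {}"
proof -
  have "0 < norm x / d + 1" "norm x \<le> d * (norm x / d + 1)"
    using d_pos by (auto simp: field_simps add_pos_nonneg)
  then show ?thesis
    using scaled_mem by blast
qed

lemma gauge_norm_nonneg: "0 \<le> gauge_norm x"
  unfolding gauge_norm_def using gauge_norm_set_nonempty by (intro cInf_greatest) auto

lemma mem_if_gauge_norm_less:
  assumes "gauge_norm x < t"
  shows "(1 / t) *\<^sub>R x \<in> K"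
proof -
  obtain s where s: "0 < s" "(1 / s) *\<^sub>R x \<in> K" "s < t"
    using cInf_lessD[OF gauge_norm_set_nonempty, of x t] assms unfolding gauge_norm_def by auto
  have "(s / t) *\<^sub>R ((1 / s) *\<^sub>R x) + (1 - s / t) *\<^sub>R 0 \<in> K"
    using s by (intro convexD[OF convex _ zero_mem]) auto
  then show ?thesis
    using s by simp
qed

lemma gauge_norm_le_1: "x \<in> K \<Longrightarrow> gauge_norm x \<le> 1"
  using gauge_norm_le[of 1 x] by simp

text \<open>The unit ball of the gauge may be larger than \<open>K\<close>, because \<open>K\<close> may fail to be closed. Still, the
  vectors of gauge less than \<open>t\<close> lie in \<open>t\<close> times \<open>K\<close>, so a linear functional has the same supremum
  on both. Slices of the unit ball are thus determined by values on \<open>K\<close>, hence on generators of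
  \<open>K\<close>, without any separation theorem.\<close>

lemma linear_le_gauge_norm:
  assumes "linear g" and "\<And>y. y \<in> K \<Longrightarrow> g y \<le> c" and "0 \<le> c"
  shows "g x \<le> c * gauge_norm x"
proof (rule field_le_epsilon)
  fix r :: real assume "0 < r"
  \<comment> \<open>The denominator \<open>c + 1\<close> covers the case \<open>c = 0\<close>; only \<open>c * r / (c + 1) \<le> r\<close> matters.\<close>
  define t where "t = gauge_norm x + r / (c + 1)"
  have t: "0 < t" "gauge_norm x < t"
    using \<open>0 < r\<close> \<open>0 \<le> c\<close> gauge_norm_nonneg[of x] by (auto simp: t_def add_nonneg_pos)
  have "g x = t * g ((1 / t) *\<^sub>R x)"
    using t by (simp add: linear_scale[OF \<open>linear g\<close>])
  also have "\<dots> \<le> t * c"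
    using t assms(2) mem_if_gauge_norm_less by (intro mult_left_mono) auto
  also have "\<dots> \<le> c * gauge_norm x + r"
    using \<open>0 < r\<close> \<open>0 \<le> c\<close> by (simp add: t_def algebra_simps) (simp add: field_simps)
  finally show "g x \<le> c * gauge_norm x + r" .
qed

lemma gauge_norm_le_norm: "gauge_norm x \<le> norm x / d"
proof (rule field_le_epsilon)
  fix r :: real assume "0 < r"
  then show "gauge_norm x \<le> norm x / d + r"
    using d_pos by (intro gauge_norm_le scaled_mem) (auto simp: field_simps add_nonneg_pos)
qed

lemma norm_le_gauge_norm: "norm x \<le> R * gauge_norm x"
proof (rule field_le_epsilon)
  fix r :: real assume "0 < r"
  have R: "0 \<le> R"
    using norm_bound[OF zero_mem] by simp
  define t where "t = gauge_norm x + r / (R + 1)"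
  have t: "0 < t" "gauge_norm x < t"
    using \<open>0 < r\<close> R gauge_norm_nonneg[of x] by (auto simp: t_def add_nonneg_pos)
  have "norm x = t * norm ((1 / t) *\<^sub>R x)"
    using t by simp
  also have "\<dots> \<le> t * R"
    using t by (intro mult_left_mono norm_bound mem_if_gauge_norm_less) auto
  also have "\<dots> \<le> R * gauge_norm x + r"
    using \<open>0 < r\<close> R by (simp add: t_def algebra_simps) (simp add: field_simps)
  finally show "norm x \<le> R * gauge_norm x + r" .
qed

lemma gauge_norm_triangle: "gauge_norm (x + y) \<le> gauge_norm x + gauge_norm y"
proof (rule field_le_epsilon)
  fix r :: real assume "0 < r"
  define s t where "s = gauge_norm x + r / 2" and "t = gauge_norm y + r / 2"
  have pos: "0 < s" "0 < t"
    using \<open>0 < r\<close> gauge_norm_nonneg[of x] gauge_norm_nonneg[of y] by (auto simp: s_def t_def)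
  have "(s / (s + t)) *\<^sub>R ((1 / s) *\<^sub>R x) + (t / (s + t)) *\<^sub>R ((1 / t) *\<^sub>R y) \<in> K"
    using pos \<open>0 < r\<close>
    by (intro convexD[OF convex mem_if_gauge_norm_less mem_if_gauge_norm_less])
      (simp_all add: s_def t_def flip: add_divide_distrib)
  then have "(1 / (s + t)) *\<^sub>R (x + y) \<in> K"
    using pos by (simp add: scaleR_add_right)
  then have "gauge_norm (x + y) \<le> s + t"
    using pos by (intro gauge_norm_le) auto
  then show "gauge_norm (x + y) \<le> gauge_norm x + gauge_norm y + r"
    by (simp add: s_def t_def)
qed

lemma gauge_norm_le_1_closure:
  assumes "x \<in> closure K"
  shows "gauge_norm x \<le> 1"
proof (rule field_le_epsilon)
  fix r :: real assume "0 < r"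
  then obtain y where y: "y \<in> K" "dist y x < d * r"
    using assms d_pos by (meson closure_approachable mult_pos_pos)
  have "gauge_norm (y + (x - y)) \<le> gauge_norm y + gauge_norm (x - y)"
    by (rule gauge_norm_triangle)
  also have "\<dots> \<le> 1 + norm (x - y) / d"
    using y by (intro add_mono gauge_norm_le_1 gauge_norm_le_norm)
  also have "\<dots> \<le> 1 + r"
    using y d_pos by (simp add: dist_norm norm_minus_commute field_simps)
  finally show "gauge_norm x \<le> 1 + r" by simp
qed

lemma gauge_norm_scaleR_le: "gauge_norm (c *\<^sub>R x) \<le> \<bar>c\<bar> * gauge_norm x"
proof (cases "c = 0")
  case True
  then show ?thesis
    using gauge_norm_le_norm[of 0] by simp
next
  case False
  show ?thesis
  proof (rule field_le_epsilon)
    fix r :: real assume "0 < r"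
    define t where "t = gauge_norm x + r / \<bar>c\<bar>"
    have t: "0 < t" "gauge_norm x < t"
      using \<open>0 < r\<close> False gauge_norm_nonneg[of x] by (auto simp: t_def add_nonneg_pos)
    have "(1 / (\<bar>c\<bar> * t)) *\<^sub>R (c *\<^sub>R x) = sgn c *\<^sub>R ((1 / t) *\<^sub>R x)"
      using False t by (simp add: sgn_if field_simps)
    moreover have "sgn c *\<^sub>R ((1 / t) *\<^sub>R x) \<in> K"
      using mem_if_gauge_norm_less[OF t(2)] symmetric[OF mem_if_gauge_norm_less[OF t(2)]] False
      by (auto simp: sgn_if)
    ultimately have "gauge_norm (c *\<^sub>R x) \<le> \<bar>c\<bar> * t"
      using False t by (intro gauge_norm_le) auto
    then show "gauge_norm (c *\<^sub>R x) \<le> \<bar>c\<bar> * gauge_norm x + r"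
      using False by (simp add: t_def algebra_simps)
  qed
qed

lemma gauge_norm_scaleR: "gauge_norm (c *\<^sub>R x) = \<bar>c\<bar> * gauge_norm x"
proof (cases "c = 0")
  case True
  then show ?thesis
    using gauge_norm_scaleR_le[of 0 x] gauge_norm_nonneg[of 0] by simp
next
  case False
  have "\<bar>c\<bar> * gauge_norm x = \<bar>c\<bar> * gauge_norm ((1 / c) *\<^sub>R (c *\<^sub>R x))"
    using False by simp
  also have "\<dots> \<le> \<bar>c\<bar> * (\<bar>1 / c\<bar> * gauge_norm (c *\<^sub>R x))"
    by (intro mult_left_mono gauge_norm_scaleR_le) auto
  also have "\<dots> = gauge_norm (c *\<^sub>R x)"
    using False by simp
  finally show ?thesis
    using gauge_norm_scaleR_le[of c x] by simp
qed

lemma equivalent_gauge_norm: "equivalent_norm gauge_norm"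
proof -
  have "is_norm gauge_norm"
    unfolding is_norm_def
  proof (intro conjI allI)
    fix x show "gauge_norm x = 0 \<longleftrightarrow> x = 0"
      using norm_le_gauge_norm[of x] gauge_norm_scaleR[of 0 0] by auto
  qed (auto simp: gauge_norm_nonneg gauge_norm_scaleR gauge_norm_triangle)
  moreover have "(1 / (\<bar>R\<bar> + 1)) * norm x \<le> gauge_norm x" for x
  proof -
    have "norm x \<le> (\<bar>R\<bar> + 1) * gauge_norm x"
      using norm_le_gauge_norm[of x] gauge_norm_nonneg[of x]
      by (smt (verit, best) mult_right_mono)
    then show ?thesis
      by (simp add: field_simps add_nonneg_pos)
  qed
  moreover have "gauge_norm x \<le> (1 / d) * norm x" for x
    using gauge_norm_le_norm[of x] by simp
  ultimately show ?thesis
    unfolding equivalent_norm_def using d_pos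
    by (intro conjI exI[of _ "1 / (\<bar>R\<bar> + 1)"] exI[of _ "1 / d"]) (auto simp: add_nonneg_pos)
qed

end

section \<open>Continuity of the coefficients of a complemented basis\<close>

text \<open>Taking the coefficients of \<open>P x\<close> makes them functions on the whole space, which is a Baire space
  and in which the approximation below can be carried out. The sets of vectors on which all partial
  sums are bounded by \<open>k\<close> exhaust the space, so the closure of one of
  them has an interior point. Differences then approximate every \<open>x\<close> within \<open>norm x / 2\<close> by some \<open>w\<close>
  whose partial sums are at most a constant times \<open>norm x\<close>. Repeating this on the remainder writes
  \<open>x\<close> as a series of such vectors with geometrically decreasing bounds. The expansions of its terms
  may be added coefficientwise, and uniqueness of the expansion shows that the result is the
  expansion of \<open>P x\<close>, whose partial sums therefore obey the summed bound.\<close>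

lemma basis_partial_sums_bounded:
  fixes e :: "nat \<Rightarrow> 'a::banach" and c :: "nat \<Rightarrow> 'a \<Rightarrow> real" and P :: "'a \<Rightarrow> 'a"
  assumes P: "bounded_linear P"
    and c: "\<And>n. linear (c n)"
    and sums: "\<And>x. (\<lambda>n. c n x *\<^sub>R e n) sums P x"
    and unique: "\<And>b x. (\<lambda>n. b n *\<^sub>R e n) sums P x \<Longrightarrow> b = (\<lambda>n. c n x)"
  obtains M where "\<And>n x. norm (\<Sum>i<n. c i x *\<^sub>R e i) \<le> M * norm x"
proof -
  define T where "T n x = (\<Sum>i<n. c i x *\<^sub>R e i)" for n x
  have T_lim: "(\<lambda>n. T n x) \<longlonglongrightarrow> P x" for x
    using sums[of x] by (simp add: sums_def T_def)
  have T_lin: "linear (T n)" for n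
    by (rule linearI)
      (simp_all add: T_def linear_add[OF c] linear_scale[OF c] scaleR_add_left sum.distrib scaleR_sum_right)
  \<comment> \<open>If \<open>e n\<close> were zero, its coefficient could be changed freely in the expansion of zero.\<close>
  have e_nz: "e n \<noteq> 0" for n
  proof
    assume "e n = 0"
    then have "(\<lambda>k. (if k = n then 1 else 0) *\<^sub>R e k) = (\<lambda>k. 0)"
      by auto
    then have "(\<lambda>k. (if k = n then 1 else 0) *\<^sub>R e k) sums P 0"
      using linear_0[OF bounded_linear.linear[OF P]] by simp
    from fun_cong[OF unique[OF this], of n] have "c n 0 = 1"
      by simp
    then show False
      by (simp add: linear_0[OF c])
  qed
  define A where "A k = {x. \<forall>n. norm (T n x) \<le> real k}" for k
  have "(\<Union>k. closure (A k)) = UNIV"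
  proof -
    have "\<exists>k. x \<in> A k" for x
    proof -
      have "Bseq (\<lambda>n. T n x)"
        using T_lim convergentI convergent_imp_Bseq by blast
      then obtain B where "\<And>n. norm (T n x) \<le> B"
        by (auto simp: Bseq_def)
      moreover obtain k where "B \<le> real k"
        using real_arch_simple by blast
      ultimately have "x \<in> A k"
        unfolding A_def by (auto intro: order_trans)
      then show ?thesis ..
    qed
    then have "x \<in> (\<Union>k. closure (A k))" for x
      using closure_subset[of "A _"] by (meson UN_I UNIV_I subsetD)
    then show ?thesis
      by (simp add: set_eq_iff)
  qed
  then have "\<exists>k. interior (closure (A k)) \<noteq> {}"
    using Baire_category_alt[of "euclidean :: 'a topology" "range (\<lambda>k. closure (A k))"]
      completely_metrizable_space_euclidean by auto
  then obtain k y r where r: "0 < r" "ball y r \<subseteq> closure (A k)"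
    by (metis all_not_in_conv mem_interior)
  have approx_small: "\<exists>w. norm (x - w) < \<epsilon> \<and> (\<forall>n. norm (T n w) \<le> 2 * real k)"
    if "norm x < r" "0 < \<epsilon>" for x \<epsilon>
  proof -
    have "y + x \<in> closure (A k)" "y \<in> closure (A k)"
      using r that by (auto simp: subset_iff dist_norm)
    then obtain a b where ab: "a \<in> A k" "dist a (y + x) < \<epsilon> / 2" "b \<in> A k" "dist b y < \<epsilon> / 2"
      using \<open>0 < \<epsilon>\<close> by (meson closure_approachable half_gt_zero)
    have "x - (a - b) = (y + x - a) - (y - b)"
      by simp
    then have "norm (x - (a - b)) = norm ((y + x - a) - (y - b))"
      by (rule arg_cong)
    also have "\<dots> \<le> norm (y + x - a) + norm (y - b)"
      by (rule norm_triangle_ineq4)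
    also have "\<dots> < \<epsilon>"
      using ab by (simp add: dist_norm norm_minus_commute)
    finally have "norm (x - (a - b)) < \<epsilon>" .
    moreover have "norm (T n (a - b)) \<le> 2 * real k" for n
    proof -
      have "norm (T n (a - b)) \<le> norm (T n a) + norm (T n b)"
        by (simp add: linear_diff[OF T_lin] norm_triangle_ineq4)
      also have "\<dots> \<le> real k + real k"
        using ab by (intro add_mono) (auto simp: A_def)
      finally show ?thesis by simp
    qed
    ultimately show ?thesis by blast
  qed
  define M where "M = 4 * real k / r"
  have approx: "\<exists>w. norm (x - w) \<le> norm x / 2 \<and> (\<forall>n. norm (T n w) \<le> M * norm x)" for x
  proof (cases "x = 0")
    case True
    then show ?thesis
      by (intro exI[of _ 0]) (simp add: linear_0[OF T_lin])
  next
    case False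
    \<comment> \<open>Rescale \<open>x\<close> into the ball of radius \<open>r\<close>; its norm becomes \<open>r / 2\<close>.\<close>
    define s where "s = r / (2 * norm x)"
    have s: "0 < s" "norm (s *\<^sub>R x) < r"
      using r False by (auto simp: s_def)
    obtain w where w: "norm (s *\<^sub>R x - w) < r / 4" "\<And>n. norm (T n w) \<le> 2 * real k"
      using approx_small[OF s(2), of "r / 4"] r by auto
    have "norm (x - (1 / s) *\<^sub>R w) = (1 / s) * norm (s *\<^sub>R x - w)"
    proof -
      have "x - (1 / s) *\<^sub>R w = (1 / s) *\<^sub>R (s *\<^sub>R x - w)"
        using s by (simp add: algebra_simps)
      then show ?thesis using s by simp
    qed
    also have "\<dots> \<le> (1 / s) * (r / 4)"
      using w s by (intro mult_left_mono) auto
    also have "\<dots> = norm x / 2"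
      using r False by (simp add: s_def)
    finally have "norm (x - (1 / s) *\<^sub>R w) \<le> norm x / 2" .
    moreover have "norm (T n ((1 / s) *\<^sub>R w)) \<le> M * norm x" for n
    proof -
      have "norm (T n ((1 / s) *\<^sub>R w)) = (1 / s) * norm (T n w)"
        using s by (simp add: linear_scale[OF T_lin])
      also have "\<dots> \<le> (1 / s) * (2 * real k)"
        using w s by (intro mult_left_mono) auto
      also have "\<dots> = M * norm x"
        using r False by (simp add: s_def M_def)
      finally show ?thesis .
    qed
    ultimately show ?thesis by blast
  qed
  obtain W where W: "\<And>x. norm (x - W x) \<le> norm x / 2" "\<And>x n. norm (T n (W x)) \<le> M * norm x"
    using approx by metis
  have "norm (T n x) \<le> 2 * M * norm x" for n x
  proof -
    define rem where "rem j = ((\<lambda>z. z - W z) ^^ j) x" for j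
    define w where "w j = W (rem j)" for j
    have rem_Suc: "rem (Suc j) = rem j - w j" for j
      by (simp add: rem_def w_def)
    have rem_le: "norm (rem j) \<le> norm x * (1/2) ^ j" for j
    proof (induction j)
      case 0
      then show ?case by (simp add: rem_def)
    next
      case (Suc j)
      have "norm (rem (Suc j)) \<le> norm (rem j) / 2"
        using W(1) by (simp add: rem_Suc w_def)
      then show ?case using Suc by simp
    qed
    have M: "0 \<le> M"
      using r by (simp add: M_def)
    have Tw: "norm (T n (w j)) \<le> M * norm x * (1/2) ^ j" for n j
    proof -
      have "norm (T n (w j)) \<le> M * norm (rem j)"
        unfolding w_def by (rule W(2))
      also have "\<dots> \<le> M * (norm x * (1/2) ^ j)"
        by (intro mult_left_mono rem_le M)
      finally show ?thesis by (simp add: mult.assoc)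
    qed
    have summable_geo: "summable (\<lambda>j. C * (1/2) ^ j :: real)" for C
      by (intro summable_mult) simp
    have summable_Tw: "summable (\<lambda>j. T n (w j))" for n
      by (rule summable_comparison_test'[OF summable_geo[of "M * norm x"], of 0]) (rule Tw)
    have sum_w: "(\<Sum>j<J. w j) = x - rem J" for J
      by (induction J) (simp_all add: rem_Suc, simp add: rem_def)
    have "rem \<longlonglongrightarrow> 0"
    proof (rule Lim_null_comparison)
      show "\<forall>\<^sub>F j in sequentially. norm (rem j) \<le> norm x * (1/2) ^ j"
        using rem_le by simp
      show "(\<lambda>j. norm x * (1/2) ^ j) \<longlonglongrightarrow> 0"
        by (intro tendsto_mult_right_zero LIMSEQ_power_zero) simp
    qed
    then have "(\<lambda>J. \<Sum>j<J. w j) \<longlonglongrightarrow> x"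
      unfolding sum_w using tendsto_diff[OF tendsto_const[of x]] by fastforce
    then have "(\<lambda>J. P (\<Sum>j<J. w j)) \<longlonglongrightarrow> P x"
      by (rule bounded_linear.tendsto[OF P])
    then have P_sum: "(\<lambda>J. \<Sum>j<J. P (w j)) \<longlonglongrightarrow> P x"
      by (simp add: linear_sum[OF bounded_linear.linear[OF P]])
    \<comment> \<open>The geometric bound is uniform in \<open>n\<close>, so the limit in \<open>n\<close> and the sum over \<open>j\<close> commute.\<close>
    have lim: "(\<lambda>n. \<Sum>j. T n (w j)) \<longlonglongrightarrow> P x"
    proof (rule swap_uniform_limit'[OF _ P_sum])
      show "\<forall>\<^sub>F J in sequentially. (\<lambda>n. \<Sum>j<J. T n (w j)) \<longlonglongrightarrow> (\<Sum>j<J. P (w j))"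
        by (intro always_eventually allI tendsto_sum T_lim)
      show "uniform_limit UNIV (\<lambda>J n. \<Sum>j<J. T n (w j)) (\<lambda>n. \<Sum>j. T n (w j)) sequentially"
        by (rule Weierstrass_m_test[OF _ summable_geo[of "M * norm x"]]) (rule Tw)
    qed auto
    have summable_c: "summable (\<lambda>j. c i (w j))" for i
    proof -
      have "c i (w j) *\<^sub>R e i = T (Suc i) (w j) - T i (w j)" for j
        by (simp add: T_def)
      then have "norm (c i (w j)) * norm (e i) = norm (T (Suc i) (w j) - T i (w j))" for j
        by (metis norm_scaleR real_norm_def)
      moreover have "norm (T (Suc i) (w j) - T i (w j)) \<le> 2 * (M * norm x * (1/2) ^ j)" for j
        using Tw[of "Suc i" j] Tw[of i j] norm_triangle_ineq4[of "T (Suc i) (w j)" "T i (w j)"]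
        by linarith
      ultimately have bound: "norm (c i (w j)) \<le> 2 * (M * norm x * (1/2) ^ j) / norm (e i)" for j
        using e_nz[of i] by (simp only: pos_le_divide_eq zero_less_norm_iff not_False_eq_True)
      have "summable (\<lambda>j. 2 * (M * norm x * (1/2) ^ j) / norm (e i))"
        by (intro summable_divide summable_mult summable_geo)
      then show ?thesis
        by (rule summable_comparison_test'[where N = 0]) (rule bound)
    qed
    have "(\<Sum>j. T n (w j)) = (\<Sum>i<n. (\<Sum>j. c i (w j)) *\<^sub>R e i)" for n
    proof -
      have "(\<Sum>j. T n (w j)) = (\<Sum>i<n. \<Sum>j. c i (w j) *\<^sub>R e i)"
        unfolding T_def by (intro suminf_sum summable_scaleR_left summable_c)
      then show ?thesis
        by (simp add: suminf_scaleR_left[OF summable_c])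
    qed
    with lim have "(\<lambda>i. (\<Sum>j. c i (w j)) *\<^sub>R e i) sums P x"
      by (simp add: sums_def)
    from fun_cong[OF unique[OF this]] have "c i x = (\<Sum>j. c i (w j))" for i
      by simp
    then have "T n x = (\<Sum>j. T n (w j))"
      using \<open>(\<Sum>j. T n (w j)) = _\<close> by (simp add: T_def)
    also have "norm \<dots> \<le> (\<Sum>j. M * norm x * (1/2) ^ j)"
      by (rule norm_suminf_le[OF _ summable_geo[of "M * norm x"]]) (rule Tw)
    also have "\<dots> = 2 * M * norm x"
      using suminf_mult[of "\<lambda>j. (1/2::real) ^ j" "M * norm x"] suminf_geometric[of "1/2::real"] by simp
    finally show ?thesis .
  qed
  then show thesis
    using that unfolding T_def by blast
qed

text \<open>The coefficient functionals of the basis are extended to the whole space by composing with the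
  projection, which replaces the Hahn-Banach theorem. Normalising the basis vectors keeps the
  functionals uniformly bounded, since each term of an expansion is a difference of two
  consecutive partial sums.\<close>

lemma complemented_basic_sequence_biorthogonal:
  fixes e :: "nat \<Rightarrow> 'a::banach"
  assumes basis: "basic_sequence e" and compl: "complemented_subspace (closed_span (range e))"
  obtains v :: "nat \<Rightarrow> 'a" and \<phi> :: "nat \<Rightarrow> 'a \<Rightarrow> real" and C
  where "\<And>n. norm (v n) = 1" "\<And>n. linear (\<phi> n)" "\<And>n x. \<bar>\<phi> n x\<bar> \<le> C * norm x"
    and "\<And>m n. \<phi> m (v n) = of_bool (m = n)"
proof -
  let ?Y = "closed_span (range e)"
  obtain P where P: "bounded_linear P" "\<And>x. P (P x) = P x" "range P = ?Y"
    using compl unfolding complemented_subspace_def by blast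
  have P_lin: "linear P"
    by (rule bounded_linear.linear[OF P(1)])
  have ex1: "\<exists>!a. (\<lambda>n. a n *\<^sub>R e n) sums P x" for x
    using conjunct2[OF basis[unfolded basic_sequence_def schauder_basis_of_def P(3)[symmetric]]]
    by (rule bspec) (rule rangeI)
  define c where "c n x = (THE a. (\<lambda>n. a n *\<^sub>R e n) sums P x) n" for n x
  have sums: "(\<lambda>n. c n x *\<^sub>R e n) sums P x" for x
    unfolding c_def using theI'[OF ex1] .
  have unique: "b = (\<lambda>n. c n x)" if "(\<lambda>n. b n *\<^sub>R e n) sums P x" for b x
    unfolding c_def by (simp add: the1_equality[OF ex1[of x], of b] that)
  have c_lin: "linear (c n)" for n
  proof (rule linearI)
    fix x y
    have "(\<lambda>n. (c n x + c n y) *\<^sub>R e n) sums P (x + y)"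
      using sums_add[OF sums sums] by (simp add: scaleR_add_left linear_add[OF P_lin])
    from fun_cong[OF unique[OF this], of n] show "c n (x + y) = c n x + c n y"
      by simp
  next
    fix s x
    have "(\<lambda>n. (s * c n x) *\<^sub>R e n) sums P (s *\<^sub>R x)"
      using sums_scaleR_right[OF sums] by (simp add: linear_scale[OF P_lin])
    from fun_cong[OF unique[OF this], of n] show "c n (s *\<^sub>R x) = s *\<^sub>R c n x"
      by simp
  qed
  obtain M where M: "\<And>n x. norm (\<Sum>i<n. c i x *\<^sub>R e i) \<le> M * norm x"
    using basis_partial_sums_bounded[OF P(1) c_lin sums unique] by blast
  have c_e: "c m (e n) = of_bool (m = n)" for m n
  proof -
    have "range e \<subseteq> range P"
      using basis unfolding basic_sequence_def schauder_basis_of_def P(3) by (rule conjunct1)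
    then have "e n \<in> range P"
      by (simp add: image_subset_iff)
    then have "P (e n) = e n"
      using P(2) by auto
    moreover have "(\<lambda>k. (of_bool (k = n) :: real) *\<^sub>R e k) = (\<lambda>k. if k = n then e k else 0)"
      by auto
    ultimately have "(\<lambda>k. of_bool (k = n) *\<^sub>R e k) sums P (e n)"
      using sums_single[of n e] by simp
    from fun_cong[OF unique[OF this], of m] show ?thesis
      by simp
  qed
  have e_nz: "e n \<noteq> 0" for n
    using c_e[of n n] linear_0[OF c_lin] by auto
  show thesis
  proof (rule that[of "\<lambda>n. (1 / norm (e n)) *\<^sub>R e n" "\<lambda>n x. norm (e n) * c n x" "2 * M"])
    show "norm ((1 / norm (e n)) *\<^sub>R e n) = 1" for n
      using e_nz by simp
    show "linear (\<lambda>x. norm (e n) * c n x)" for n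
      using linear_compose_scale_right[OF c_lin] by simp
    show "\<bar>norm (e n) * c n x\<bar> \<le> 2 * M * norm x" for n x
    proof -
      have "\<bar>norm (e n) * c n x\<bar> = norm ((\<Sum>i<Suc n. c i x *\<^sub>R e i) - (\<Sum>i<n. c i x *\<^sub>R e i))"
        by (simp add: abs_mult)
      also have "\<dots> \<le> M * norm x + M * norm x"
        by (intro order_trans[OF norm_triangle_ineq4] add_mono M)
      finally show ?thesis by simp
    qed
    show "norm (e m) * c m ((1 / norm (e n)) *\<^sub>R e n) = of_bool (m = n)" for m n
      using e_nz by (simp add: linear_scale[OF c_lin] c_e)
  qed
qed

section \<open>The renorming\<close>

lemma linear_le_on_convex_hull:
  fixes g :: "'a::real_vector \<Rightarrow> real"
  assumes "linear g" and "\<And>y. y \<in> A \<Longrightarrow> g y \<le> c" and "x \<in> convex hull A"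
  shows "g x \<le> c"
proof -
  have "convex hull A \<subseteq> g -` {..c}"
    using assms(1,2) by (intro hull_minimal convex_linear_vimage) auto
  then show ?thesis
    using assms(3) by auto
qed

lemma symmetric_convex_hull:
  fixes A :: "'a::real_vector set"
  assumes "\<And>x. x \<in> A \<Longrightarrow> - x \<in> A" and "x \<in> convex hull A"
  shows "- x \<in> convex hull A"
proof -
  have "(\<lambda>x. (-1) *\<^sub>R x) ` A = A"
    using assms(1) by (force simp: image_iff)
  then have "convex hull A = (\<lambda>x. (-1) *\<^sub>R x) ` (convex hull A)"
    using convex_hull_scaling[of "-1" A] by simp
  then show ?thesis
    using assms(2) by (metis imageI scaleR_minus1_left)
qed

text \<open>The unit ball is generated by the points \<open>z + 2 *\<^sub>R w\<close> with \<open>w \<in> U\<close>, their negatives, and a small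
  ball that makes the new norm equivalent. Zero being a limit of convex combinations of \<open>U\<close>, the
  point \<open>z\<close> is a limit of convex combinations of the points \<open>z + 2 *\<^sub>R w\<close>, so it has norm at most \<open>1\<close>,
  though it is not a generator. On the generators \<open>f\<close> exceeds \<open>1 / 2\<close> only at the points
  \<open>z + 2 *\<^sub>R w\<close>. Every slice of the ball contains a generator, so every slice inside
  \<open>{f > 1 / 2}\<close> contains some \<open>z + 2 *\<^sub>R w\<close>, whose distance to \<open>z\<close> is twice the norm of \<open>w\<close> and at most \<open>2\<close>. The
  functional \<open>h\<close> belonging to \<open>w\<close> takes values in \<open>{-1..1}\<close> on \<open>z + 2 *\<^sub>R U\<close> because \<open>h z = - 1\<close> and
  \<open>h\<close> maps \<open>U\<close> to \<open>{0..1}\<close>; it is therefore in the new dual ball, and \<open>h w = 1\<close> forces \<open>w\<close> to have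
  norm at least \<open>1\<close>.\<close>

lemma relative_daugavet_renorming:
  fixes z :: "'a::real_normed_vector" and U :: "'a set" and f :: "'a \<Rightarrow> real"
  assumes U_bound: "\<And>w. w \<in> U \<Longrightarrow> norm w \<le> B"
    and null: "0 \<in> closure (convex hull U)"
    and C: "0 < C"
    and f: "linear f" "\<And>x. \<bar>f x\<bar> \<le> C * norm x" "f z = 1" "\<And>w. w \<in> U \<Longrightarrow> f w = 0"
    and norming: "\<And>w. w \<in> U \<Longrightarrow> \<exists>h. linear h \<and> (\<forall>x. \<bar>h x\<bar> \<le> C * norm x) \<and>
      h z = - 1 \<and> h w = 1 \<and> h ` U \<subseteq> {0..1}"
  shows "\<exists>N. equivalent_norm N \<and> relative_daugavet_point N z"
proof -
  \<comment> \<open>With this radius \<open>f\<close> and all \<open>h\<close> are at most \<open>1 / 2\<close> in modulus on the small ball.\<close>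
  define d where "d = 1 / (2 * C)"
  define V where "V = (\<lambda>w. z + 2 *\<^sub>R w) ` U"
  define G where "G = V \<union> uminus ` V \<union> cball 0 d"
  define R where "R = norm z + 2 * B + d"
  have d: "0 < d"
    using C by (simp add: d_def)
  have small: "\<bar>g y\<bar> \<le> 1 / 2" if "y \<in> cball 0 d" "\<And>x. \<bar>g x\<bar> \<le> C * norm x"
    for y and g :: "'a \<Rightarrow> real"
  proof -
    have "C * norm y \<le> C * d"
      using that C by (intro mult_left_mono) auto
    then show ?thesis
      using that(2)[of y] C by (simp add: d_def)
  qed
  have symG: "- y \<in> G" if "y \<in> G" for y
    using that by (auto simp: G_def)
  have boundG: "norm y \<le> R" if "y \<in> G" for y
  proof -
    have V: "norm v \<le> norm z + 2 * B" if "v \<in> V" for v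
      using that U_bound by (force simp: V_def intro: norm_triangle_le)
    have "U \<noteq> {}"
      using null by auto
    then have "0 \<le> B"
      using U_bound norm_ge_zero order_trans by blast
    then have "0 \<le> norm z + 2 * B"
      by simp
    then show ?thesis
      using that V[of y] V[of "- y"] d by (auto simp: G_def R_def)
  qed
  have "convex hull G \<subseteq> cball 0 R"
    using boundG by (intro hull_minimal) auto
  then have "norm y \<le> R" if "y \<in> convex hull G" for y
    using that by auto
  then interpret symmetric_convex_body "convex hull G" d R
    using d symG
    by unfold_locales (auto intro: symmetric_convex_hull hull_inc simp: G_def)
  let ?N = gauge_norm
  have G_le: "?N y \<le> 1" if "y \<in> G" for y
    using that by (intro gauge_norm_le_1 hull_inc)
  have sup_on_G: "g x \<le> c * ?N x" if "linear g" "\<And>y. y \<in> G \<Longrightarrow> g y \<le> c" "0 \<le> c"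
    for g :: "'a \<Rightarrow> real" and c x
    using that linear_le_on_convex_hull by (intro linear_le_gauge_norm) blast+
  have abs_le_N: "\<bar>g x\<bar> \<le> ?N x" if "linear g" "\<And>y. y \<in> G \<Longrightarrow> \<bar>g y\<bar> \<le> 1"
    for g :: "'a \<Rightarrow> real" and x
  proof -
    have "g x \<le> 1 * ?N x"
      using that by (intro sup_on_G) (auto simp: abs_le_iff)
    moreover have "- g x \<le> 1 * ?N x"
      using that by (intro sup_on_G linear_compose_neg) (auto simp: abs_le_iff)
    ultimately show ?thesis by simp
  qed
  have f_V: "f v = 1" if "v \<in> V" for v
    using that f by (auto simp: V_def linear_add[OF f(1)] linear_scale[OF f(1)])
  have f_le: "\<bar>f x\<bar> \<le> ?N x" for x
  proof (rule abs_le_N[OF f(1)])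
    show "\<bar>f y\<bar> \<le> 1" if "y \<in> G" for y
      using that f_V small[of y f] f(2) by (fastforce simp: G_def linear_neg[OF f(1)])
  qed
  have N_U: "1 \<le> ?N w" if "w \<in> U" for w
  proof -
    obtain h where h: "linear h" "\<And>x. \<bar>h x\<bar> \<le> C * norm x" "h z = - 1" "h w = 1" "h ` U \<subseteq> {0..1}"
      using norming[OF \<open>w \<in> U\<close>] by blast
    have "\<bar>h v\<bar> \<le> 1" if "v \<in> V" for v
      using that h(3,5) by (force simp: V_def linear_add[OF h(1)] linear_scale[OF h(1)])
    then have "\<bar>h y\<bar> \<le> 1" if "y \<in> G" for y
      using that small[of y h] h(2) by (fastforce simp: G_def linear_neg[OF h(1)])
    then have "\<bar>h w\<bar> \<le> ?N w"
      by (rule abs_le_N[OF h(1)])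
    then show ?thesis
      using h(4) by simp
  qed
  have N_z: "?N z = 1"
  proof (rule antisym)
    have "z + 2 *\<^sub>R 0 \<in> closure ((\<lambda>w. z + 2 *\<^sub>R w) ` (convex hull U))"
    proof -
      have "(\<lambda>w. z + 2 *\<^sub>R w) ` closure (convex hull U)
          \<subseteq> closure ((\<lambda>w. z + 2 *\<^sub>R w) ` (convex hull U))"
        by (intro image_closure_subset closed_closure closure_subset) (intro continuous_intros)
      then show ?thesis
        using null by blast
    qed
    moreover have "(\<lambda>w. z + 2 *\<^sub>R w) ` (convex hull U) \<subseteq> convex hull G"
      unfolding convex_hull_affinity[symmetric] by (intro hull_mono) (auto simp: G_def V_def)
    ultimately have "z \<in> closure (convex hull G)"
      using closure_mono[of "(\<lambda>w. z + 2 *\<^sub>R w) ` (convex hull U)"] by auto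
    then show "?N z \<le> 1"
      by (rule gauge_norm_le_1_closure)
    show "1 \<le> ?N z"
      using f_le[of z] f(3) by simp
  qed
  then have z_mem: "z \<in> unit_ball ?N"
    by (simp add: unit_ball_def)
  have f_dual: "f \<in> dual ?N"
    unfolding dual_def using f(1) f_le by (auto intro!: exI[of _ 1])
  have "dual_norm ?N f = 1"
    unfolding dual_norm_def
  proof (rule cSup_eq_maximum)
    show "1 \<in> (\<lambda>x. \<bar>f x\<bar>) ` unit_ball ?N"
      using z_mem f(3) by (intro image_eqI[of _ _ z]) auto
    show "y \<le> 1" if "y \<in> (\<lambda>x. \<bar>f x\<bar>) ` unit_ball ?N" for y
      using that f_le by (auto simp: unit_ball_def intro: order_trans)
  qed
  then have "f \<in> supporting_functionals ?N z"
    using f_dual f(3) by (simp add: supporting_functionals_def)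
  then have supp: "is_supporting_slice ?N z (slice ?N f (1/2))"
    unfolding is_supporting_slice_def by (intro bexI[of _ f] exI[of _ "1/2"]) auto
  have f_sup: "(SUP x\<in>unit_ball ?N. f x) = 1"
  proof (rule cSup_eq_maximum)
    show "1 \<in> f ` unit_ball ?N"
      using z_mem f(3) by (intro image_eqI[of _ _ z]) auto
    show "y \<le> 1" if "y \<in> f ` unit_ball ?N" for y
      using that f_le by (auto simp: unit_ball_def abs_le_iff intro: order_trans)
  qed
  have "(SUP y\<in>T. ?N (z - y)) = 2" if T: "is_slice ?N T" "T \<subseteq> slice ?N f (1/2)" for T
  proof -
    obtain g \<beta> where g: "g \<in> dual ?N" "0 < \<beta>" "T = slice ?N g \<beta>"
      using T(1) unfolding is_slice_def by blast
    then have g_lin: "linear g"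
      by (simp add: dual_def)
    define m where "m = (SUP x\<in>unit_ball ?N. g x)"
    have "\<exists>y\<in>G. m - \<beta> < g y"
    proof (rule ccontr)
      assume "\<not> ?thesis"
      then have le: "g y \<le> m - \<beta>" if "y \<in> G" for y
        using that by force
      \<comment> \<open>A bound on the generators extends to the unit ball only if it is nonnegative.\<close>
      have "0 \<in> G"
        using d by (simp add: G_def)
      then have nonneg: "0 \<le> m - \<beta>"
        using le[of 0] linear_0[OF g_lin] by simp
      have "m \<le> m - \<beta>"
        unfolding m_def
      proof (rule cSUP_least, fold m_def)
        show "unit_ball ?N \<noteq> {}"
          using z_mem by auto
        fix x assume "x \<in> unit_ball ?N"
        then have "(m - \<beta>) * ?N x \<le> (m - \<beta>) * 1"
          using nonneg by (intro mult_left_mono) (auto simp: unit_ball_def)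
        then show "g x \<le> m - \<beta>"
          using sup_on_G[OF g_lin le nonneg, of x] by simp
      qed
      then show False
        using g(2) by simp
    qed
    then obtain p where p: "p \<in> G" "m - \<beta> < g p"
      by blast
    then have pT: "p \<in> T"
      using g(3) G_le by (simp add: slice_def unit_ball_def m_def)
    then have "f p > 1 / 2"
      using T(2) by (auto simp: slice_def f_sup)
    then have "p \<in> V"
      using p(1) f_V small[of p f] f(2) by (force simp: G_def linear_neg[OF f(1)])
    then obtain w where w: "w \<in> U" "p = z + 2 *\<^sub>R w"
      by (auto simp: V_def)
    have upper: "?N (z - y) \<le> 2" if "?N y \<le> 1" for y
      using gauge_norm_triangle[of z "- y"] gauge_norm_scaleR[of "-1" y] N_z that by simp
    show ?thesis
    proof (rule cSup_eq_maximum)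
      have "?N (z - p) = 2 * ?N w"
        using w gauge_norm_scaleR[of "-2" w] by simp
      then have "?N (z - p) = 2"
        using N_U[OF w(1)] upper[OF G_le[OF p(1)]] by simp
      then show "2 \<in> (\<lambda>y. ?N (z - y)) ` T"
        using pT by (metis imageI)
      show "y \<le> 2" if "y \<in> (\<lambda>y. ?N (z - y)) ` T" for y
        using that upper g(3) by (auto simp: slice_def unit_ball_def)
    qed
  qed
  then have "relative_daugavet_point ?N z"
    unfolding relative_daugavet_point_def daugavet_point_relative_to_def
    using N_z supp by (intro exI[of _ "slice ?N f (1/2)"]) (auto simp: unit_sphere_def)
  then show ?thesis
    using equivalent_gauge_norm by blast
qed

text \<open>Arrange the vectors other than \<open>v 0\<close> in a double array and use the first \<open>k + 1\<close> entries of row \<open>k\<close>.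
  In this row, subtract from each of the first \<open>k\<close> vectors their common mean and add the last one divided by
  \<open>k\<close>. The mean of the resulting \<open>k\<close> vectors \<open>u k i\<close> is that last vector divided by \<open>k\<close>, which tends
  to zero in norm. The coefficients of \<open>u k i\<close> at the first \<open>k\<close> vectors are \<open>- 1 / k\<close> up to the
  additional \<open>1\<close> at \<open>i\<close>; adding the coefficient \<open>1 / k\<close> at the last vector cancels the negative
  part, so a sum of two coefficient functionals is biorthogonal to the \<open>u k i\<close>. Subtracting
  \<open>\<phi> 0\<close> gives it the value \<open>- 1\<close> at \<open>v 0\<close>.\<close>

lemma relative_daugavet_renorming_of_biorthogonal:
  fixes v :: "nat \<Rightarrow> 'a::real_normed_vector" and \<phi> :: "nat \<Rightarrow> 'a \<Rightarrow> real"
  assumes v: "\<And>n. norm (v n) = 1"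
    and \<phi>: "\<And>n. linear (\<phi> n)" "\<And>n x. \<bar>\<phi> n x\<bar> \<le> C * norm x"
    and biorth: "\<And>m n. \<phi> m (v n) = of_bool (m = n)"
  shows "\<exists>N. equivalent_norm N \<and> relative_daugavet_point N (v 0)"
proof -
  \<comment> \<open>The successor keeps the index \<open>0\<close> for the point \<open>v 0\<close> itself.\<close>
  define idx where "idx k i = Suc (prod_encode (k, i))" for k i
  have idx_eq: "idx k i = idx l j \<longleftrightarrow> k = l \<and> i = j" and idx_pos: "idx k i \<noteq> 0" "0 \<noteq> idx k i" for k i l j
    by (auto simp: idx_def dest: inj_onD[OF inj_prod_encode])
  define u where "u k i = v (idx k i) - (1 / real k) *\<^sub>R (\<Sum>j<k. v (idx k j))
      + (1 / real k) *\<^sub>R v (idx k k)" for k i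
  \<comment> \<open>Row \<open>0\<close> is empty, so no division by zero occurs.\<close>
  define U where "U = {u k i | k i. i < k}"
  have u_coeff: "\<phi> n (u k i) = of_bool (n = idx k i) - (1 / real k) * (\<Sum>j<k. of_bool (n = idx k j))
      + (1 / real k) * of_bool (n = idx k k)" for n k i
    by (simp add: u_def linear_add[OF \<phi>(1)] linear_diff[OF \<phi>(1)] linear_scale[OF \<phi>(1)]
        linear_sum[OF \<phi>(1)] biorth)
  have C: "1 \<le> C"
    using \<phi>(2)[of 0 "v 0"] v[of 0] biorth[of 0 0] by simp
  show ?thesis
  proof (rule relative_daugavet_renorming[of U 3 "3 * C" "\<phi> 0"])
    show "norm w \<le> 3" if "w \<in> U" for w
    proof -
      obtain k i where ki: "w = u k i" "i < k"
        using \<open>w \<in> U\<close> unfolding U_def by blast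
      have "norm (\<Sum>j<k. v (idx k j)) \<le> real k"
        using sum_norm_le[of "{..<k}" "\<lambda>j. v (idx k j)" "\<lambda>_. 1"] v by simp
      then have "norm ((1 / real k) *\<^sub>R (\<Sum>j<k. v (idx k j))) \<le> 1"
        using ki by (simp add: field_simps)
      moreover have "norm ((1 / real k) *\<^sub>R v (idx k k)) \<le> 1"
        using ki v by (simp add: field_simps)
      ultimately show ?thesis
        unfolding ki u_def using v[of "idx k i"]
        by (intro norm_triangle_le order_trans[OF add_mono[OF norm_triangle_ineq4 order_refl]]) linarith
    qed
    show "0 \<in> closure (convex hull U)"
      unfolding closure_sequential
    proof (intro exI[of _ "\<lambda>k. (1 / real (Suc k)) *\<^sub>R v (idx (Suc k) (Suc k))"] conjI allI)
      fix k :: nat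
      define K where "K = Suc k"
      have "(\<Sum>i<K. u K i) = (\<Sum>i<K. v (idx K i))
          - real K *\<^sub>R ((1 / real K) *\<^sub>R (\<Sum>j<K. v (idx K j))) + real K *\<^sub>R ((1 / real K) *\<^sub>R v (idx K K))"
        by (simp only: u_def sum.distrib sum_subtractf sum_constant_scaleR card_lessThan)
      also have "\<dots> = v (idx K K)"
        by (simp add: K_def del: of_nat_Suc)
      finally have "(\<Sum>i<K. u K i) = v (idx K K)" .
      then have "(\<Sum>i<K. (1 / real K) *\<^sub>R u K i) = (1 / real K) *\<^sub>R v (idx K K)"
        by (simp add: scaleR_sum_right[symmetric])
      moreover have "(\<Sum>i<K. (1 / real K) *\<^sub>R u K i) \<in> convex hull U"
        by (intro convex_sum) (auto simp: K_def U_def intro!: hull_inc)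
      ultimately show "(1 / real (Suc k)) *\<^sub>R v (idx (Suc k) (Suc k)) \<in> convex hull U"
        by (simp add: K_def)
    next
      show "(\<lambda>k. (1 / real (Suc k)) *\<^sub>R v (idx (Suc k) (Suc k))) \<longlonglongrightarrow> 0"
        by (rule Lim_null_comparison[OF _ LIMSEQ_inverse_real_of_nat])
          (simp add: v field_simps)
    qed
    show "0 < 3 * C"
      using C by simp
    show "\<bar>\<phi> 0 x\<bar> \<le> 3 * C * norm x" for x
      using \<phi>(2)[of 0 x] by simp
    show "\<phi> 0 w = 0" if "w \<in> U" for w
      using that by (auto simp: U_def u_coeff idx_pos)
    show "\<exists>h. linear h \<and> (\<forall>x. \<bar>h x\<bar> \<le> 3 * C * norm x) \<and> h (v 0) = - 1 \<and> h w = 1 \<and> h ` U \<subseteq> {0..1}"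
      if "w \<in> U" for w
    proof -
      obtain k i where ki: "w = u k i" "i < k"
        using \<open>w \<in> U\<close> unfolding U_def by blast
      define h where "h x = \<phi> (idx k i) x + \<phi> (idx k k) x - \<phi> 0 x" for x
      have h_u: "h (u l j) = of_bool (l = k \<and> j = i)" if "j < l" for l j
      proof -
        have "(\<Sum>j<l. of_bool (k = l \<and> i = j)) = (of_bool (k = l) :: real)"
          using \<open>i < k\<close> by (cases "k = l") (simp_all add: of_bool_def)
        moreover have "(\<Sum>j<l. of_bool (k = l \<and> k = j)) = (0 :: real)"
          by (auto intro!: sum.neutral)
        ultimately show ?thesis
          using that \<open>i < k\<close> by (auto simp: h_def u_coeff idx_eq idx_pos)
      qed
      have "linear h"
        unfolding h_def by (intro linear_compose_add linear_compose_sub \<phi>(1))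
      moreover have "\<bar>h x\<bar> \<le> 3 * C * norm x" for x
        using \<phi>(2)[of "idx k i" x] \<phi>(2)[of "idx k k" x] \<phi>(2)[of 0 x] by (simp add: h_def)
      moreover have "h (v 0) = - 1"
        by (simp add: h_def biorth idx_pos)
      moreover have "h w = 1" "h ` U \<subseteq> {0..1}"
        using ki by (auto simp: h_u U_def)
      ultimately show ?thesis by blast
    qed
  qed (simp_all add: \<phi>(1) biorth)
qed

theorem corollary3p13:
  fixes e :: "nat \<Rightarrow> 'a::banach"
  assumes "infinite_dimensional TYPE('a)"
    and "weakly_null e"
    and "basic_sequence e"
    and "complemented_subspace (closed_span (range e))"
  shows "\<exists>N :: 'a \<Rightarrow> real. equivalent_norm N \<and> (\<exists>z. relative_daugavet_point N z)"
proof -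
  obtain v :: "nat \<Rightarrow> 'a" and \<phi> :: "nat \<Rightarrow> 'a \<Rightarrow> real" and C
    where "\<And>n. norm (v n) = 1" "\<And>n. linear (\<phi> n)" "\<And>n x. \<bar>\<phi> n x\<bar> \<le> C * norm x"
      and "\<And>m n. \<phi> m (v n) = of_bool (m = n)"
    using complemented_basic_sequence_biorthogonal[OF assms(3,4)] by blast
  then show ?thesis
    using relative_daugavet_renorming_of_biorthogonal by blast
qed

end
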